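(* Let $n>1$ be an integer, let $p,q\ge 0$ be integers with $2p\le q$, and let $t=q-p$. Let $A$ be the set of all $t$-restricted multisets with elements from $[n]=\{1,\dots,n\}$ whose size $k$ (counted with multiplicity) satisfies $p\le k\le q$, and let $A'$ be the set of strings encoding the elements of $A$. Then there exists a universal cycle for $A'$.
   Context: A multiset $M$ with elements from $[n]$ is encoded by the string $a_1a_2\cdots a_n$, where $a_i\ge 0$ is the number of times $i$ appears in $M$; it is $t$-restricted if each $a_i\le t$. Thus $A'$ is the set of words $a_1\cdots a_n$ over $\{0,1,\dots,t\}$ with $p\le\sum_i a_i\le q$. A universal cycle for a finite set $A'$ of words of length $n$ over a finite alphabet is a cyclic sequence $c_0c_1\cdots c_{L-1}$ of letters, with $L=|A'|$, such that every word of $A'$ occurs exactly once among the $L$ windows $c_ic_{i+1}\cdots c_{i+n-1}$, $0\le i<L$ (indices modulo $L$). *)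

theory Defs
  imports Main "HOL-Library.Multiset"
begin

definition restricted_multisets :: "nat \<Rightarrow> nat \<Rightarrow> nat \<Rightarrow> nat \<Rightarrow> nat multiset set" where
  "restricted_multisets n t p q =
     {M. set_mset M \<subseteq> {1..n} \<and> (\<forall>i\<in>{1..n}. count M i \<le> t) \<and> p \<le> size M \<and> size M \<le> q}"

definition encoding :: "nat \<Rightarrow> nat multiset \<Rightarrow> nat list" where
  "encoding n M = map (count M) [1..<n + 1]"

definition cyclic_window :: "'a list \<Rightarrow> nat \<Rightarrow> nat \<Rightarrow> 'a list" where
  "cyclic_window c n i = map (\<lambda>j. c ! ((i + j) mod length c)) [0..<n]"

(* W is meant to be a finite set of words of length n over the alphabet S; the cycle may be
   shorter than n, in which case a window wraps around it more than once. *)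
definition universal_cycle :: "'a set \<Rightarrow> nat \<Rightarrow> 'a list set \<Rightarrow> 'a list \<Rightarrow> bool" where
  "universal_cycle S n W c \<longleftrightarrow>
     set c \<subseteq> S \<and> length c = card W \<and>
     (\<forall>w\<in>W. \<exists>!i. i < length c \<and> cyclic_window c n i = w)"

end

theory Submission imports Defs "Graph_Theory.Euler" begin

text \<open>
  Form the de Bruijn digraph whose arcs are the words of length \<open>n\<close>, the word \<open>w\<close> leading from
  \<open>butlast w\<close> to \<open>tl w\<close>. In a closed Euler trail consecutive words overlap in all but one letter,
  so the first letters of its arcs spell out a universal cycle
  (\<open>cyclic_window_of_closed_trail\<close>). It remains to see that the digraph is balanced and connected.

  Both facts rest on the set of words being closed under rotation. First, rotation maps the arcs
  entering a vertex bijectively to the arcs leaving it. Secondly, rotating a word means walking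
  along its arc, while two words that differ only in the last letter start at the same vertex.
  Hence a change of one letter, at any position, never leaves the component, and the digraph is
  connected as soon as any two words are linked by changes of single letters that stay
  inside the set (\<open>universal_cycle_if_rotation_closed\<close>).

  Such a linking exists for the words over \<open>{0..t}\<close> with letter sum between \<open>p\<close> and \<open>q\<close>.
  Lowering letters one by one brings the sum down to \<open>p\<close>. Then the units are moved one at a time
  to the first letter, each time raising the first letter before lowering another one. The
  first letter stays at most \<open>p\<close>, and \<open>p \<le> t\<close> because \<open>2 * p \<le> q\<close>. The sum rises only to
  \<open>p + 1\<close>, and \<open>p + 1 \<le> q\<close> since \<open>p\<close> is positive when there is a unit to move. Every word is thus linked to \<open>(p, 0, \<dots>, 0)\<close>.
\<close>

section \<open>Universal cycles from closed trails\<close>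

definition de_bruijn :: "'a list set \<Rightarrow> ('a list, 'a list) pre_digraph" where
  "de_bruijn W = \<lparr>verts = butlast ` W, arcs = W, tail = butlast, head = tl\<rparr>"

lemma de_bruijn_simps [simp]:
  "verts (de_bruijn W) = butlast ` W" "arcs (de_bruijn W) = W"
  "tail (de_bruijn W) = butlast" "head (de_bruijn W) = tl"
  by (simp_all add: de_bruijn_def)

lemma (in pre_digraph) tail_nth_if_cas:
  assumes "cas u p v" "i < length p"
  shows "tail G (p ! i) = (if i = 0 then u else head G (p ! (i - 1)))"
  using assms
proof (induction p arbitrary: u i)
  case (Cons e es)
  then show ?case
    by (cases i; cases "i - 1") auto
qed simp

lemma (in pre_digraph) head_last_if_cas:
  "cas u p v \<Longrightarrow> p \<noteq> [] \<Longrightarrow> head G (last p) = v"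
  by (induction p arbitrary: u) auto

lemma (in pre_digraph) head_nth_if_closed_cas:
  assumes "cas u p u" "i < length p"
  shows "head G (p ! i) = tail G (p ! (Suc i mod length p))"
proof (cases "Suc i = length p")
  case True
  then have "p \<noteq> []" "i = length p - 1" by auto
  then have "head G (p ! i) = u" "tail G (p ! 0) = u"
    using head_last_if_cas[OF assms(1)] tail_nth_if_cas[OF assms(1), of 0]
    by (simp_all add: last_conv_nth)
  then show ?thesis using True by simp
next
  case False
  then show ?thesis
    using assms tail_nth_if_cas[OF assms(1), of "Suc i"] by simp
qed

text \<open>
  Along a closed trail the letter at position \<open>j > 0\<close> of a word is the letter at position \<open>j - 1\<close> of
  the next word, and so on, until it becomes the first letter of the word \<open>j\<close> steps later.
\<close>

lemma cyclic_window_of_closed_trail: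
  assumes cas: "pre_digraph.cas (de_bruijn W) u p u"
    and len: "\<And>w. w \<in> set p \<Longrightarrow> length w = n" and i: "i < length p"
  shows "cyclic_window (map hd p) n i = p ! i"
proof -
  have first: "p ! i ! j = hd (p ! ((i + j) mod length p))" if "i < length p" "j < n" for i j
    using that
  proof (induction j arbitrary: i)
    case 0
    then have "length (p ! i) = n" by (simp add: len)
    then show ?case using 0 by (cases "p ! i") auto
  next
    case (Suc j)
    define i' where "i' = Suc i mod length p"
    have "length p > 0" using Suc.prems by linarith
    then have i': "i' < length p" by (simp add: i'_def)
    have l: "length (p ! i) = n" "length (p ! i') = n"
      using Suc.prems i' by (simp_all add: len)
    have "p ! i ! Suc j = tl (p ! i) ! j"
      using Suc.prems l by (simp add: nth_tl)
    also have "tl (p ! i) = butlast (p ! i')"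
      using pre_digraph.head_nth_if_closed_cas[OF cas Suc.prems(1)] by (simp add: i'_def)
    also have "butlast (p ! i') ! j = p ! i' ! j"
      using Suc.prems l by (simp add: nth_butlast)
    also have "\<dots> = hd (p ! ((i' + j) mod length p))"
      using Suc i' by simp
    also have "(i' + j) mod length p = (i + Suc j) mod length p"
      by (simp add: i'_def mod_simps)
    finally show ?case .
  qed
  have "length p > 0" using i by linarith
  then show ?thesis
    using first[OF i] i by (intro nth_equalityI) (auto simp: cyclic_window_def len)
qed

text \<open>
  The window starting at each index is the arc of the trail with that index, and an Euler trail
  runs through every arc exactly once.
\<close>

lemma universal_cycle_of_euler_trail:
  assumes trail: "pre_digraph.euler_trail (de_bruijn W) u p u"
    and len: "\<And>w. w \<in> W \<Longrightarrow> length w = n" and "n > 0"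
    and letters: "\<And>w. w \<in> W \<Longrightarrow> set w \<subseteq> S"
  shows "universal_cycle S n W (map hd p)"
proof -
  have p: "set p = W" "distinct p" "pre_digraph.cas (de_bruijn W) u p u"
    using trail
    unfolding pre_digraph.euler_trail_def pre_digraph.trail_def pre_digraph.awalk_def de_bruijn_simps
    by blast+
  have window: "cyclic_window (map hd p) n i = p ! i" if "i < length p" for i
    by (rule cyclic_window_of_closed_trail[OF p(3)]) (use p(1) len that in simp_all)
  have "hd w \<in> S" if "w \<in> W" for w
  proof -
    have "w \<noteq> []" using len[OF that] \<open>n > 0\<close> by force
    then show ?thesis using letters[OF that] hd_in_set by blast
  qed
  then have "set (map hd p) \<subseteq> S"
    unfolding set_map p(1) by blast
  moreover have "length (map hd p) = card W"
    unfolding length_map p(1)[symmetric] distinct_card[OF p(2)] ..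
  moreover have "\<exists>!i. i < length (map hd p) \<and> cyclic_window (map hd p) n i = w" if "w \<in> W" for w
  proof -
    have "w \<in> set p" using that p(1) by simp
    then obtain i where "i < length p" "p ! i = w"
      by (metis in_set_conv_nth)
    then show ?thesis
      using window nth_eq_iff_index_eq[OF p(2)] unfolding length_map by metis
  qed
  ultimately show ?thesis
    unfolding universal_cycle_def by blast
qed

section \<open>Sets of words closed under rotation\<close>

lemma butlast_rotate1: "w \<noteq> [] \<Longrightarrow> butlast (rotate1 w) = tl w"
  by (cases w) auto

text \<open>The head of an arc is the tail of its rotation, hence a vertex.\<close>

lemma wf_digraph_de_bruijn:
  assumes rot: "\<And>w. w \<in> W \<Longrightarrow> rotate1 w \<in> W" and ne: "[] \<notin> W"
  shows "wf_digraph (de_bruijn W)"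
proof
  fix w assume "w \<in> arcs (de_bruijn W)"
  then have w: "rotate1 w \<in> W" "w \<noteq> []" using rot ne by auto
  show "head (de_bruijn W) w \<in> verts (de_bruijn W)"
    using imageI[OF w(1), of butlast] butlast_rotate1[OF w(2)] by simp
qed simp

text \<open>An arc \<open>a # v\<close> enters \<open>v\<close>, and its rotation \<open>v @ [a]\<close> leaves \<open>v\<close>.\<close>

lemma de_bruijn_balanced:
  assumes "finite W" and rot: "\<And>w. w \<in> W \<Longrightarrow> rotate1 w \<in> W"
    and ne: "[] \<notin> W"
  shows "in_degree (de_bruijn W) v = out_degree (de_bruijn W) v"
proof -
  have inj: "inj (rotate1 :: 'a list \<Rightarrow> 'a list)"
    by (rule inj_rotate1)
  \<comment> \<open>an injective self-map of a finite set is onto, so rotating backwards stays in \<open>W\<close>\<close>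
  have onto: "rotate1 ` W = W"
  proof (rule endo_inj_surj[OF assms(1)])
    show "rotate1 ` W \<subseteq> W" using rot by blast
    show "inj_on rotate1 W" using inj by (rule inj_on_subset) simp
  qed
  have "rotate1 ` {w \<in> W. tl w = v} = {w \<in> W. butlast w = v}"
  proof (intro equalityI subsetI)
    fix x assume "x \<in> {w \<in> W. butlast w = v}"
    then obtain w where w: "w \<in> W" "x = rotate1 w" "butlast x = v"
      using onto by (metis (mono_tags, lifting) image_iff mem_Collect_eq)
    then have "w \<noteq> []" using ne by metis
    then have "tl w = v" using butlast_rotate1 w by metis
    then show "x \<in> rotate1 ` {w \<in> W. tl w = v}"
      using w by blast
  next
    fix x assume "x \<in> rotate1 ` {w \<in> W. tl w = v}"
    then obtain w where w: "w \<in> W" "tl w = v" "x = rotate1 w" by blast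
    then have "w \<noteq> []" using ne by metis
    then show "x \<in> {w \<in> W. butlast w = v}"
      using w rot by (simp add: butlast_rotate1)
  qed
  moreover have "card (rotate1 ` {w \<in> W. tl w = v}) = card {w \<in> W. tl w = v}"
    by (rule card_image, rule inj_on_subset[OF inj]) simp
  ultimately show ?thesis
    by (simp add: in_degree_def out_degree_def in_arcs_def out_arcs_def)
qed

definition letter_change :: "'a list set \<Rightarrow> ('a list \<times> 'a list) set" where
  "letter_change W = {(v, w). v \<in> W \<and> w \<in> W \<and> (\<exists>i x. i < length v \<and> w = v[i := x])}"

lemma letter_changeI:
  "v \<in> W \<Longrightarrow> v[i := x] \<in> W \<Longrightarrow> i < length v \<Longrightarrow> (v, v[i := x]) \<in> letter_change W"
  by (auto simp: letter_change_def)

text \<open>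
  The component of a word is unaffected by rotation and by replacing the last letter. To replace
  the letter at position \<open>i\<close>, rotate it into the last position, replace it there and rotate back.
\<close>

lemma de_bruijn_connected:
  assumes "w0 \<in> W" and rot: "\<And>w. w \<in> W \<Longrightarrow> rotate1 w \<in> W"
    and ne: "[] \<notin> W"
    and link: "\<And>w. w \<in> W \<Longrightarrow> (w, w0) \<in> (letter_change W)\<^sup>*"
  shows "connected (de_bruijn W)"
proof -
  let ?G = "mk_symmetric (de_bruijn W)"
  interpret wf_digraph "de_bruijn W"
    using rot ne by (rule wf_digraph_de_bruijn)
  interpret S: pair_wf_digraph ?G ..
  note sym = symmetric_reachable[OF symmetric_mk_symmetric]
  define R where "R v w \<longleftrightarrow> butlast v \<rightarrow>\<^sup>*\<^bsub>?G\<^esub> butlast w" for v w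
  have R_sym: "R w v" if "R v w" for v w
    using that sym by (auto simp: R_def)
  have R_trans: "R u w" if "R u v" "R v w" for u v w
    using that S.reachable_trans by (auto simp: R_def)
  have R_refl: "R w w" if "w \<in> W" for w
    using that by (auto simp: R_def)
  have rotate: "rotate k w \<in> W \<and> R w (rotate k w)" if "w \<in> W" for k w
  proof (induction k)
    case 0
    show ?case using that R_refl by simp
  next
    case (Suc k)
    let ?v = "rotate k w"
    have v: "?v \<in> W" "?v \<noteq> []" using Suc ne by auto
    have "(butlast ?v, tl ?v) \<in> parcs ?G"
      using v by (auto simp: parcs_mk_symmetric)
    then have "R ?v (rotate1 ?v)"
      unfolding R_def butlast_rotate1[OF v(2)] by (intro S.reachable_adjI) simp
    then have "R w (rotate1 ?v)" using Suc R_trans by blast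
    then show ?case using rot[OF v(1)] by simp
  qed
  have change: "R v (v[i := x])" if "v \<in> W" "v[i := x] \<in> W" "i < length v" for v i x
  proof -
    let ?r = "rotate (Suc i)"
    have "butlast (?r w) = drop (Suc i) w @ take i w" if "i < length w" for w :: "'a list"
    proof -
      have "?r w = drop (Suc i) w @ take (Suc i) w"
        using that by (cases "Suc i = length w") (auto simp: rotate_drop_take)
      then show ?thesis
        using that by (simp add: take_Suc_conv_app_nth butlast_append)
    qed
    then have "butlast (?r v) = butlast (?r (v[i := x]))"
      using that(3) by simp
    moreover have "R (?r v) (?r v)"
      using R_refl rotate[OF that(1)] by blast
    ultimately have "R (?r v) (?r (v[i := x]))"
      unfolding R_def by metis
    then show ?thesis
      using rotate[OF that(1)] rotate[OF that(2)] R_trans R_sym by blast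
  qed
  have "R w w0" if "w \<in> W" for w
    using link[OF that]
  proof (induction rule: converse_rtrancl_induct)
    case base
    show ?case using R_refl assms(1) by simp
  next
    case (step v w)
    from step.hyps(1) obtain i x where "v \<in> W" "w \<in> W" "i < length v" "w = v[i := x]"
      unfolding letter_change_def by blast
    then have "R v w" using change by metis
    then show ?case using step.IH R_trans by metis
  qed
  then have "R v w" if "v \<in> W" "w \<in> W" for v w
    using that R_sym R_trans by metis
  then have "u \<rightarrow>\<^sup>*\<^bsub>?G\<^esub> v" if "u \<in> butlast ` W" "v \<in> butlast ` W" for u v
    using that unfolding R_def by (metis imageE)
  moreover have "butlast ` W \<noteq> {}"
    using assms(1) by blast
  ultimately show ?thesis
    by (simp add: connected_def strongly_connected_def)
qed

lemma universal_cycle_if_rotation_closed: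
  assumes "finite W" "w0 \<in> W" "n > 0"
    and len: "\<And>w. w \<in> W \<Longrightarrow> length w = n"
    and letters: "\<And>w. w \<in> W \<Longrightarrow> set w \<subseteq> S"
    and rot: "\<And>w. w \<in> W \<Longrightarrow> rotate1 w \<in> W"
    and link: "\<And>w. w \<in> W \<Longrightarrow> (w, w0) \<in> (letter_change W)\<^sup>*"
  shows "\<exists>c. universal_cycle S n W c"
proof -
  have ne: "[] \<notin> W" using len \<open>n > 0\<close> by fastforce
  interpret wf_digraph "de_bruijn W"
    using rot ne by (rule wf_digraph_de_bruijn)
  interpret fin_digraph "de_bruijn W"
    using assms(1) by unfold_locales simp_all
  have "connected (de_bruijn W)"
    using de_bruijn_connected[OF assms(2) rot ne link] .
  then obtain u p where "euler_trail u p u"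
    using closed_euler1 de_bruijn_balanced[OF assms(1) rot ne] by blast
  then show ?thesis
    using universal_cycle_of_euler_trail len letters \<open>n > 0\<close> by blast
qed

section \<open>Words with bounded letters and bounded sum\<close>

definition bounded_words :: "nat \<Rightarrow> nat \<Rightarrow> nat \<Rightarrow> nat \<Rightarrow> nat list set" where
  "bounded_words n t p q =
     {w. length w = n \<and> set w \<subseteq> {0..t} \<and> p \<le> sum_list w \<and> sum_list w \<le> q}"

lemma finite_bounded_words: "finite (bounded_words n t p q)"
  by (rule finite_subset[OF _ finite_lists_length_eq[of "{0..t}" n]])
    (auto simp: bounded_words_def)

lemma rotate1_bounded_words:
  "w \<in> bounded_words n t p q \<Longrightarrow> rotate1 w \<in> bounded_words n t p q"
  by (cases w) (auto simp: bounded_words_def)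

lemma update_bounded_words:
  assumes "w \<in> bounded_words n t p q" "i < n" "x \<le> t"
    and "p + w ! i \<le> sum_list w + x" "sum_list w + x \<le> q + w ! i"
  shows "w[i := x] \<in> bounded_words n t p q"
proof -
  have "w ! i \<le> sum_list w"
    using assms by (intro member_le_sum_list) (auto simp: bounded_words_def)
  then show ?thesis
    using assms set_update_subset_insert[of w i x]
    by (auto simp: bounded_words_def sum_list_update)
qed

text \<open>Lowering a positive letter by one stays in the set as long as the sum exceeds \<open>p\<close>.\<close>

lemma linked_to_sum_eq_p:
  assumes "w \<in> bounded_words n t p q"
  shows "\<exists>v \<in> bounded_words n t p q. sum_list v = p
           \<and> (w, v) \<in> (letter_change (bounded_words n t p q))\<^sup>*"
  using assms
proof (induction "sum_list w" arbitrary: w rule: less_induct)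
  case less
  show ?case
  proof (cases "sum_list w = p")
    case False
    then have gt: "sum_list w > p" using less.prems by (auto simp: bounded_words_def)
    then obtain i where i: "i < length w" "w ! i > 0"
      by (metis gr0I in_set_conv_nth not_less_zero sum_list_eq_0_iff)
    let ?w = "w[i := w ! i - 1]"
    have "w ! i \<le> t" "sum_list w \<le> q" "length w = n"
      using less.prems i by (auto simp: bounded_words_def dest: nth_mem)
    then have w: "?w \<in> bounded_words n t p q"
      using i gt by (intro update_bounded_words[OF less.prems]) auto
    have "w ! i \<le> sum_list w" using i by (intro member_le_sum_list) auto
    then have "sum_list ?w < sum_list w" using i by (simp add: sum_list_update)
    from less.hyps[OF this w] show ?thesis
      using letter_changeI[OF less.prems w i(1)] by (meson converse_rtrancl_into_rtrancl)
  qed (use less.prems in blast)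
qed

text \<open>
  A unit moves to the first letter in two changes. Raising the first letter comes first, because
  lowering another letter from sum \<open>p\<close> would violate the lower bound.
\<close>

lemma linked_within_sum_eq_p:
  assumes "w \<in> bounded_words n t p q" "sum_list w = p" "n > 0" "p \<le> t" "t + p \<le> q"
  shows "(w, p # replicate (n - 1) 0) \<in> (letter_change (bounded_words n t p q))\<^sup>*"
  using assms
proof (induction "p - hd w" arbitrary: w rule: less_induct)
  case less
  let ?B = "bounded_words n t p q"
  have len: "length w = n" using less.prems by (simp add: bounded_words_def)
  then obtain x xs where w: "w = x # xs" using less.prems by (cases w) auto
  have sum: "x + sum_list xs = p" using less.prems w by simp
  show ?case
  proof (cases "sum_list xs = 0")
    case True
    then have "xs = replicate (n - 1) 0"
      using len w by (auto simp: sum_list_eq_0_iff intro!: replicate_eqI)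
    moreover have "x = p" using True sum by linarith
    ultimately show ?thesis using w by blast
  next
    case False
    then obtain i where i: "i < length xs" "xs ! i > 0"
      by (metis gr0I in_set_conv_nth sum_list_eq_0_iff)
    have "xs ! i \<le> sum_list xs" using i by (intro member_le_sum_list) auto
    let ?u = "w[0 := x + 1]"
    let ?v = "?u[Suc i := xs ! i - 1]"
    have bounds: "x + 1 \<le> p" "xs ! i \<le> p" "p < q"
      using sum i \<open>xs ! i \<le> sum_list xs\<close> less.prems by auto
    have u: "?u \<in> ?B"
      using bounds less.prems len w by (intro update_bounded_words[OF less.prems(1)]) auto
    have v: "?v \<in> ?B"
      using bounds less.prems len w i sum
      by (intro update_bounded_words[OF u]) auto
    have sum_v: "sum_list ?v = p"
      using sum i w \<open>xs ! i \<le> sum_list xs\<close> by (simp add: sum_list_update)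
    have "p - hd ?v < p - hd w" using w bounds by simp
    from less.hyps[OF this v sum_v less.prems(3-5)]
    have "(?v, p # replicate (n - 1) 0) \<in> (letter_change ?B)\<^sup>*" .
    moreover have "(w, ?u) \<in> letter_change ?B"
      using less.prems(1) u w by (intro letter_changeI) auto
    moreover have "(?u, ?v) \<in> letter_change ?B"
      using u v w i by (intro letter_changeI) auto
    ultimately show ?thesis
      by (meson converse_rtrancl_into_rtrancl)
  qed
qed

section \<open>Encodings of multisets and the universal cycle\<close>

lemma sum_list_encoding:
  assumes "set_mset M \<subseteq> {1..n}"
  shows "sum_list (encoding n M) = size M"
proof -
  have "sum_list (encoding n M) = (\<Sum>i\<in>{1..n}. count M i)"
    by (simp add: encoding_def sum_list_distinct_conv_sum_set atLeastLessThanSuc_atLeastAtMost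
        del: upt_Suc)
  also have "\<dots> = (\<Sum>i\<in>set_mset M. count M i)"
    using assms by (intro sum.mono_neutral_right) (auto simp: not_in_iff)
  finally show ?thesis by (simp add: size_multiset_overloaded_eq)
qed

lemma encoding_restricted_multisets:
  "encoding n ` restricted_multisets n t p q = bounded_words n t p q"
proof (intro equalityI subsetI)
  fix w assume "w \<in> encoding n ` restricted_multisets n t p q"
  then show "w \<in> bounded_words n t p q"
    by (auto simp: restricted_multisets_def bounded_words_def sum_list_encoding)
      (auto simp: encoding_def simp del: upt_Suc)
next
  fix w assume w: "w \<in> bounded_words n t p q"
  define f where "f i = (if i \<in> {1..n} then w ! (i - 1) else 0)" for i
  define M where "M = Abs_multiset f"
  have "finite {i. f i > 0}"
    by (rule finite_subset[of _ "{1..n}"]) (auto simp: f_def)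
  then have M: "count M = f"
    by (simp add: M_def count_Abs_multiset)
  have enc: "encoding n M = w"
    using w by (intro nth_equalityI)
      (auto simp: bounded_words_def encoding_def M f_def simp del: upt_Suc)
  have sub: "set_mset M \<subseteq> {1..n}"
    by (auto simp: set_mset_def M f_def split: if_splits)
  have "f i \<le> t" if "i \<in> {1..n}" for i
  proof -
    have "i - 1 < length w" using that w by (auto simp: bounded_words_def)
    then have "w ! (i - 1) \<in> {0..t}"
      using w nth_mem[of "i - 1" w] unfolding bounded_words_def by blast
    then show ?thesis using that by (simp add: f_def)
  qed
  then have "M \<in> restricted_multisets n t p q"
    using sub sum_list_encoding[OF sub] w by (auto simp: restricted_multisets_def enc M bounded_words_def)
  then show "w \<in> encoding n ` restricted_multisets n t p q"
    using enc by blast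
qed

theorem theorem5:
  fixes n p q t :: nat and A :: "nat multiset set" and A' :: "nat list set"
  assumes "n > 1" and "2 * p \<le> q" and "t = q - p"
    and "A = restricted_multisets n t p q"
    and "A' = encoding n ` A"
  shows "\<exists>c. universal_cycle {0..t} n A' c"
proof -
  let ?B = "bounded_words n t p q" and ?w0 = "p # replicate (n - 1) 0"
  have A': "A' = ?B"
    using assms encoding_restricted_multisets by simp
  have bounds: "p \<le> t" "t + p \<le> q" using assms by auto
  have w0: "?w0 \<in> ?B"
    using assms(1) bounds by (auto simp: bounded_words_def sum_list_replicate)
  have "(w, ?w0) \<in> (letter_change ?B)\<^sup>*" if "w \<in> ?B" for w
  proof -
    obtain v where "v \<in> ?B" "sum_list v = p" "(w, v) \<in> (letter_change ?B)\<^sup>*"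
      using linked_to_sum_eq_p[OF \<open>w \<in> ?B\<close>] by blast
    then show ?thesis
      using linked_within_sum_eq_p[of v n t p q] assms(1) bounds
      by (meson less_trans rtrancl_trans zero_less_one)
  qed
  then show ?thesis
    unfolding A' using w0 assms(1)
    by (intro universal_cycle_if_rotation_closed[of ?B ?w0])
      (auto simp: finite_bounded_words rotate1_bounded_words, auto simp: bounded_words_def)
qed

end
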